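(* Let $L_{eq}=\{a^nb^n\mid n\ge 0\}\subseteq\{a,b\}^*$. For every $\epsilon>0$ there exists a 15-state one-way quantum finite automaton with restart $\mathcal{M}_\epsilon$ which accepts every $w\in L_{eq}$ with probability 1 and rejects every $w\in\{a,b\}^*\setminus L_{eq}$ with probability at least $1-\epsilon$. Moreover, the expected runtime of $\mathcal{M}_\epsilon$ on input $w$ is $O\big(\frac1\epsilon(2\sqrt2)^{|w|}|w|\big)$.
   Context: Let $\vdash,\dashv$ be end-markers, $\Sigma=\{a,b\}$, $\Gamma=\Sigma\cup\{\vdash,\dashv\}$. A one-way quantum finite automaton with restart over $\Sigma$ consists of a finite state set $Q$ partitioned into disjoint sets $Q_{non}$ (nonhalting), $Q_{acc}$, $Q_{rej}$, $Q_{restart}$, an initial state $q_0\in Q_{non}$, and for each $\sigma\in\Gamma$ a unitary operator $U_\sigma$ on the space with orthonormal basis $\{|q\rangle:q\in Q\}$. On input $w$ the tape contains $\vdash w\dashv$. A round starts in $|q_0\rangle$ with the head on $\vdash$; symbols are read left to right; on each symbol $\sigma$ the machine applies $U_\sigma$ and then performs the projective measurement onto the spans of $Q_{acc},Q_{rej},Q_{non},Q_{restart}$: "accept"/"reject" halt with that answer, "nonhalting" continues with the normalized projection onto the span of $Q_{non}$ on the next symbol, "restart" begins a new round from $|q_0\rangle$ on $\vdash$. Each round ends in halting or restarting with probability 1. Acceptance/rejection probabilities are those of eventually accepting/rejecting over all rounds; runtime counts all steps of all rounds. *)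

theory Defs
  imports "HOL-Probability.Probability" "HOL-Library.Numeral_Type"
begin

datatype letter = A | B

datatype tape_symbol = LeftEnd | Letter letter | RightEnd

definition tape :: "letter list \<Rightarrow> tape_symbol list" where
  "tape w = LeftEnd # map Letter w @ [RightEnd]"

definition L_eq :: "letter list set" where
  "L_eq = {replicate n A @ replicate n B | n. True}"

datatype state_class = Nonhalting | Accepting | Rejecting | Restarting

text \<open>The state set is the finite type \<open>'q\<close>, so the number of states is \<open>CARD('q)\<close>. The partition of
  the states into four disjoint sets (some of them possibly empty) is given by the map \<open>class_of\<close>.\<close>

record ('q::finite) qfa_restart =
  class_of :: "'q \<Rightarrow> state_class"
  init :: 'q
  trans_op :: "tape_symbol \<Rightarrow> complex ^ 'q ^ 'q"

definition conj_transpose :: "complex ^ 'n ^ 'm \<Rightarrow> complex ^ 'm ^ 'n" where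
  "conj_transpose M = (\<chi> i j. cnj (M $ j $ i))"

definition unitary_matrix :: "complex ^ 'n ^ 'n \<Rightarrow> bool" where
  "unitary_matrix M \<longleftrightarrow>
     conj_transpose M ** M = mat 1 \<and> M ** conj_transpose M = mat 1"

definition class_proj ::
  "('q::finite) qfa_restart \<Rightarrow> state_class \<Rightarrow> complex ^ 'q \<Rightarrow> complex ^ 'q" where
  "class_proj M k v = (\<chi> q. if class_of M q = k then v $ q else 0)"

text \<open>The probabilities below sum to 1 whenever \<open>v\<close> is a unit vector.\<close>

definition measure_outcome ::
  "('q::finite) qfa_restart \<Rightarrow> complex ^ 'q \<Rightarrow> state_class pmf" where
  "measure_outcome M v = embed_pmf (\<lambda>k. (norm (class_proj M k v))\<^sup>2)"

text \<open>\<open>Running v xs\<close>: the quantum state is \<open>v\<close> and \<open>xs\<close> is the part of the tape still to be read in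
  the current round.\<close>

datatype 'q config =
  Running "complex ^ 'q" "tape_symbol list" | Accepted | Rejected

definition start_config ::
  "('q::finite) qfa_restart \<Rightarrow> letter list \<Rightarrow> 'q config" where
  "start_config M w = Running (axis (init M) 1) (tape w)"

definition post_measurement ::
  "('q::finite) qfa_restart \<Rightarrow> letter list \<Rightarrow> complex ^ 'q \<Rightarrow> tape_symbol list
    \<Rightarrow> state_class \<Rightarrow> 'q config" where
  "post_measurement M w v xs k =
     (case k of
        Nonhalting \<Rightarrow>
          Running (inverse (norm (class_proj M Nonhalting v)) *\<^sub>R class_proj M Nonhalting v) xs
      | Accepting \<Rightarrow> Accepted
      | Rejecting \<Rightarrow> Rejected
      | Restarting \<Rightarrow> start_config M w)"

text \<open>The configurations \<open>Running v []\<close> are excluded by \<open>rounds_end\<close> below.\<close>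

fun step ::
  "('q::finite) qfa_restart \<Rightarrow> letter list \<Rightarrow> 'q config \<Rightarrow> 'q config pmf" where
  "step M w (Running v (\<sigma> # xs)) =
     (let v' = trans_op M \<sigma> *v v
      in map_pmf (post_measurement M w v' xs) (measure_outcome M v'))"
| "step M w (Running v []) = return_pmf (Running v [])"
| "step M w Accepted = return_pmf Accepted"
| "step M w Rejected = return_pmf Rejected"

text \<open>Joint distribution, at time \<open>n\<close>, of the configuration and of the number of steps performed so
  far over all rounds; the latter stops increasing once the machine has halted.\<close>

fun run ::
  "('q::finite) qfa_restart \<Rightarrow> letter list \<Rightarrow> nat \<Rightarrow> ('q config \<times> nat) pmf" where
  "run M w 0 = return_pmf (start_config M w, 0)"
| "run M w (Suc n) =
     bind_pmf (run M w n)
       (\<lambda>(c, t). map_pmf (\<lambda>c'. (c', if c \<in> {Accepted, Rejected} then t else Suc t)) (step M w c))"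

text \<open>No round continues past the right end-marker with positive probability.\<close>

definition rounds_end :: "('q::finite) qfa_restart \<Rightarrow> bool" where
  "rounds_end M \<longleftrightarrow> (\<forall>w n v t. (Running v [], t) \<notin> set_pmf (run M w n))"

definition is_qfa_restart :: "('q::finite) qfa_restart \<Rightarrow> bool" where
  "is_qfa_restart M \<longleftrightarrow>
     class_of M (init M) = Nonhalting \<and>
     (\<forall>\<sigma>. unitary_matrix (trans_op M \<sigma>)) \<and>
     rounds_end M"

text \<open>The events in the suprema increase with \<open>n\<close>, because halting configurations are never left; so
  these are the probabilities of eventually accepting and rejecting.\<close>

definition accept_prob :: "('q::finite) qfa_restart \<Rightarrow> letter list \<Rightarrow> real" where
  "accept_prob M w = (SUP n. measure_pmf.prob (run M w n) {(c, t). c = Accepted})"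

definition reject_prob :: "('q::finite) qfa_restart \<Rightarrow> letter list \<Rightarrow> real" where
  "reject_prob M w = (SUP n. measure_pmf.prob (run M w n) {(c, t). c = Rejected})"

text \<open>The step count at time \<open>n\<close> is \<open>min T n\<close> for the total runtime \<open>T\<close> (infinite if the machine never
  halts), so by monotone convergence this supremum is the expectation of \<open>T\<close>.\<close>

definition expected_runtime :: "('q::finite) qfa_restart \<Rightarrow> letter list \<Rightarrow> ennreal" where
  "expected_runtime M w =
     (SUP n. \<integral>\<^sup>+ (c, t). of_nat t \<partial>measure_pmf (run M w n))"

end

theory Submission imports Defs begin

text \<open>On \<open>a\<^sup>n b\<^sup>m\<close> two amplitudes are kept, proportional to
  \<open>P = (4/5)\<^sup>n (3/5)\<^sup>m\<close> and \<open>Q = (3/5)\<^sup>n (4/5)\<^sup>m\<close>. The remaining weight restarts, and a word with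
  an \<open>a\<close> after a \<open>b\<close> sends both amplitudes to rejecting states. At the right end-marker the round
  rejects with weight proportional to \<open>(P - Q)\<^sup>2\<close>, which is zero iff \<open>n = m\<close>, and accepts with weight
  about \<open>\<epsilon> (P + Q)\<^sup>2\<close>. Since \<open>P / Q\<close> is a power of \<open>4/3\<close>, for \<open>n \<noteq> m\<close> the two squares differ by a
  bounded factor, so rejection is more likely than acceptance by a factor \<open>1/\<epsilon>\<close>. A round halts with
  probability at least a constant times \<open>\<epsilon> (9/25)\<^bsup>|w|\<^esup>\<close>, and \<open>25/9 \<le> 2 sqrt 2\<close> gives the time bound.

  The passage from one round to the whole run uses two functions of the configuration: one whose
  expectation is preserved by each step (the probability of an outcome), and one whose expectation
  drops by at least one with each step (the remaining time).\<close>

subsection \<open>Unitary matrices\<close>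

lemma norm_vec_sq: "(norm v)\<^sup>2 = (\<Sum>i\<in>UNIV. (cmod (v $ i))\<^sup>2)" for v :: "complex ^ 'n"
  by (simp add: norm_vec_def L2_set_def sum_nonneg)

text \<open>The columns of \<open>U\<close> are orthonormal: once the squared norm is expanded and
  the sum over rows is moved innermost, only the diagonal terms survive.\<close>

lemma norm_unitary_mult:
  fixes v :: "complex ^ 'n"
  assumes "unitary_matrix U"
  shows "norm (U *v v) = norm v"
proof -
  have norm_sq: "complex_of_real ((norm x)\<^sup>2) = (\<Sum>i\<in>UNIV. cnj (x $ i) * x $ i)"
    for x :: "complex ^ 'n"
    unfolding norm_vec_sq of_real_sum
    by (intro sum.cong refl) (simp add: complex_norm_square mult.commute del: of_real_power)
  have inner: "(\<Sum>i\<in>UNIV. cnj (U $ i $ k) * U $ i $ j) = (if k = j then 1 else 0)" for k j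
  proof -
    have "(conj_transpose U ** U) $ k $ j = (mat 1 :: complex ^ 'n ^ 'n) $ k $ j"
      using assms by (simp add: unitary_matrix_def)
    then show ?thesis
      by (simp add: matrix_matrix_mult_def conj_transpose_def mat_def)
  qed
  have "(\<Sum>i\<in>UNIV. cnj ((U *v v) $ i) * (U *v v) $ i)
      = (\<Sum>i\<in>UNIV. \<Sum>k\<in>UNIV. \<Sum>j\<in>UNIV. cnj (v $ k) * v $ j * (cnj (U $ i $ k) * U $ i $ j))"
    by (simp only: matrix_vector_mult_def vec_lambda_beta cnj_sum complex_cnj_mult sum_product)
      (intro sum.cong refl, simp add: ac_simps)
  also have "\<dots> = (\<Sum>k\<in>UNIV. \<Sum>i\<in>UNIV. \<Sum>j\<in>UNIV. cnj (v $ k) * v $ j * (cnj (U $ i $ k) * U $ i $ j))"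
    by (rule sum.swap)
  also have "\<dots> = (\<Sum>k\<in>UNIV. \<Sum>j\<in>UNIV. \<Sum>i\<in>UNIV. cnj (v $ k) * v $ j * (cnj (U $ i $ k) * U $ i $ j))"
    by (intro sum.cong refl sum.swap)
  also have "\<dots> = (\<Sum>k\<in>UNIV. \<Sum>j\<in>UNIV. cnj (v $ k) * v $ j * (if k = j then 1 else 0))"
    by (simp add: inner flip: sum_distrib_left)
  also have "\<dots> = (\<Sum>k\<in>UNIV. cnj (v $ k) * v $ k)"
    by (simp add: if_distrib cong: if_cong)
  finally have "complex_of_real ((norm (U *v v))\<^sup>2) = complex_of_real ((norm v)\<^sup>2)"
    by (simp only: norm_sq)
  then have "(norm (U *v v))\<^sup>2 = (norm v)\<^sup>2"
    by (simp only: of_real_eq_iff)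
  then show ?thesis
    by (simp add: power2_eq_iff_nonneg)
qed

lemma conj_transpose_mult: "conj_transpose (M ** N) = conj_transpose N ** conj_transpose M"
  by (simp add: conj_transpose_def matrix_matrix_mult_def vec_eq_iff mult.commute)

lemma unitary_matrix_mult:
  assumes "unitary_matrix M" "unitary_matrix N"
  shows "unitary_matrix (M ** N)"
proof -
  have "conj_transpose N ** conj_transpose M ** (M ** N) = conj_transpose N ** (conj_transpose M ** M) ** N"
    "M ** N ** (conj_transpose N ** conj_transpose M) = M ** (N ** conj_transpose N) ** conj_transpose M"
    by (simp_all add: matrix_mul_assoc)
  with assms show ?thesis
    by (simp add: unitary_matrix_def conj_transpose_mult)
qed

text \<open>The Givens rotation in the plane of the axes \<open>i\<close> and \<open>j\<close>; \<open>rot i j 0 1\<close> moves the amplitude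
  of \<open>i\<close> to \<open>j\<close>.\<close>

definition rot :: "'n \<Rightarrow> 'n \<Rightarrow> real \<Rightarrow> real \<Rightarrow> complex ^ 'n ^ 'n" where
  "rot i j c s = (\<chi> p q. if p = i then (if q = i then of_real c else if q = j then - of_real s else 0)
     else if p = j then (if q = i then of_real s else if q = j then of_real c else 0)
     else if p = q then 1 else 0)"

lemma rot_mult_vec:
  fixes v :: "complex ^ 'n"
  assumes "i \<noteq> j"
  shows "rot i j c s *v v = (\<chi> p. if p = i then of_real c * v $ i - of_real s * v $ j
     else if p = j then of_real s * v $ i + of_real c * v $ j else v $ p)"
proof -
  have two: "(\<Sum>q\<in>UNIV. (if q = i then a else if q = j then b else 0) * v $ q)
      = a * v $ i + b * v $ j" for a b
  proof -
    have "(\<Sum>q\<in>UNIV. (if q = i then a else if q = j then b else 0) * v $ q)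
        = (\<Sum>q\<in>UNIV. (if q = i then a * v $ q else 0) + (if q = j then b * v $ q else 0))"
      using assms by (intro sum.cong) auto
    then show ?thesis
      by (simp add: sum.distrib)
  qed
  have one: "(\<Sum>q\<in>UNIV. (if p = q then 1 else 0) * v $ q) = v $ p" for p
    by (simp add: if_distrib[of "\<lambda>x. x * _"] cong: if_cong)
  show ?thesis
    using assms by (auto simp: vec_eq_iff rot_def matrix_vector_mult_def two one)
qed

lemma unitary_rot:
  assumes "i \<noteq> j" "c\<^sup>2 + s\<^sup>2 = 1"
  shows "unitary_matrix (rot i j c s)"
proof -
  have ct: "conj_transpose (rot i j c s) = rot i j c (- s)"
    using assms(1) by (auto simp: rot_def conj_transpose_def vec_eq_iff)
  have cs: "complex_of_real c * of_real c + of_real s * of_real s = 1"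
    using assms(2) by (metis of_real_1 of_real_add of_real_mult power2_eq_square)
  \<comment> \<open>Stated for arbitrary \<open>c\<close> and \<open>s\<close>: the conjugate
    transpose is the rotation with \<open>- s\<close>, so the other product in
    \<open>unitary_matrix\<close> is the instance at \<open>- s\<close>.\<close>
  have inv: "rot i j c s ** rot i j c (- s) = mat 1"
    if cs: "complex_of_real c * of_real c + of_real s * of_real s = 1" for c s :: real
  proof -
    have 1: "of_real c * (of_real c * x) + of_real s * (of_real s * x) = x" for x :: complex
      using arg_cong[OF cs, of "\<lambda>y. y * x"] by (simp add: algebra_simps)
    show ?thesis
      unfolding matrix_eq matrix_vector_mul_assoc[symmetric] rot_mult_vec[OF assms(1)]
      using assms(1) by (auto simp: vec_eq_iff algebra_simps 1)
  qed
  show ?thesis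
    using inv[OF cs] inv[of c "- s"] cs by (simp add: unitary_matrix_def ct)
qed

subsection \<open>A single round\<close>

lemma UNIV_state_class: "UNIV = {Nonhalting, Accepting, Rejecting, Restarting}"
  using state_class.exhaust by auto

lemma sum_class_proj:
  "(\<Sum>k\<in>UNIV. (norm (class_proj M k v))\<^sup>2) = (norm v)\<^sup>2"
proof -
  have "(\<Sum>k\<in>UNIV. (cmod (class_proj M k v $ q))\<^sup>2) = (cmod (v $ q))\<^sup>2" for q
    by (cases "class_of M q") (simp_all add: UNIV_state_class class_proj_def)
  then show ?thesis
    unfolding norm_vec_sq by (subst sum.swap) simp
qed

lemma pmf_measure_outcome:
  assumes "norm v = 1"
  shows "pmf (measure_outcome M v) k = (norm (class_proj M k v))\<^sup>2"
  unfolding measure_outcome_def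
proof (rule pmf_embed_pmf)
  have "finite (UNIV :: state_class set)"
    by (simp add: UNIV_state_class)
  then show "(\<integral>\<^sup>+ k. ennreal ((norm (class_proj M k v))\<^sup>2) \<partial>count_space UNIV) = 1"
    using assms by (simp add: nn_integral_count_space_finite sum_ennreal sum_class_proj)
qed simp

text \<open>The probability that the current round ends with outcome \<open>k\<close>, as a quadratic form in the
  unnormalized state \<open>v\<close>.\<close>

fun round_prob :: "('q::finite) qfa_restart \<Rightarrow> state_class \<Rightarrow> complex ^ 'q \<Rightarrow> tape_symbol list \<Rightarrow> real" where
  "round_prob M k v [] = 0"
| "round_prob M k v (\<sigma> # xs) = (norm (class_proj M k (trans_op M \<sigma> *v v)))\<^sup>2 +
     round_prob M k (class_proj M Nonhalting (trans_op M \<sigma> *v v)) xs"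

definition halt_prob where
  "halt_prob M v xs = round_prob M Accepting v xs + round_prob M Rejecting v xs"

lemma class_proj_scaleR: "class_proj M k (r *\<^sub>R v) = r *\<^sub>R class_proj M k v"
  by (simp add: class_proj_def vec_eq_iff)

lemma matrix_vector_scaleR: "U *v (r *\<^sub>R v) = r *\<^sub>R (U *v v)" for U :: "complex ^ 'n ^ 'm"
  by (simp add: matrix_vector_mult_def vec_eq_iff scaleR_sum_right)

lemma round_prob_scaleR: "round_prob M k (r *\<^sub>R v) xs = r\<^sup>2 * round_prob M k v xs"
proof (induction xs arbitrary: v)
  case (Cons \<sigma> xs)
  show ?case
    by (simp add: matrix_vector_scaleR class_proj_scaleR Cons.IH power_mult_distrib distrib_left)
qed simp

text \<open>The weight of a round is quadratic in the state, so the probability of continuing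
  cancels the normalization in \<open>post_measurement\<close>. For \<open>v = 0\<close> both sides
  are 0.\<close>

lemma round_prob_normalized:
  "(norm v)\<^sup>2 * round_prob M k (inverse (norm v) *\<^sub>R v) xs = round_prob M k v xs"
  using round_prob_scaleR[of M k 0 v xs]
  by (cases "v = 0") (simp_all add: round_prob_scaleR power_inverse)

lemma round_prob_nonneg: "0 \<le> round_prob M k v xs"
  by (induction xs arbitrary: v) simp_all

lemma halt_prob_Cons:
  "halt_prob M v (\<sigma> # xs) = (norm (class_proj M Accepting (trans_op M \<sigma> *v v)))\<^sup>2
     + (norm (class_proj M Rejecting (trans_op M \<sigma> *v v)))\<^sup>2
     + halt_prob M (class_proj M Nonhalting (trans_op M \<sigma> *v v)) xs"
  by (simp add: halt_prob_def)

lemma halt_prob_normalized: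
  "(norm v)\<^sup>2 * halt_prob M (inverse (norm v) *\<^sub>R v) xs = halt_prob M v xs"
  unfolding halt_prob_def by (simp add: distrib_left round_prob_normalized)

lemma class_proj_sum_unitary:
  assumes "unitary_matrix U"
  shows "(norm (class_proj M Nonhalting (U *v v)))\<^sup>2 + (norm (class_proj M Accepting (U *v v)))\<^sup>2
    + (norm (class_proj M Rejecting (U *v v)))\<^sup>2 + (norm (class_proj M Restarting (U *v v)))\<^sup>2
    = (norm v)\<^sup>2"
  using sum_class_proj[of M "U *v v"] norm_unitary_mult[OF assms, of v]
  by (simp add: UNIV_state_class)

text \<open>Each step splits the squared norm among the four outcomes; induction bounds what the
  nonhalting part can still contribute.\<close>

lemma halt_prob_le:
  assumes "\<And>\<sigma>. unitary_matrix (trans_op M \<sigma>)"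
  shows "halt_prob M v xs \<le> (norm v)\<^sup>2"
proof (induction xs arbitrary: v)
  case Nil
  then show ?case by (simp add: halt_prob_def)
next
  case (Cons \<sigma> xs)
  show ?case
    using class_proj_sum_unitary[OF assms, of M \<sigma> v] Cons.IH[of "class_proj M Nonhalting (trans_op M \<sigma> *v v)"]
      zero_le_power2[of "norm (class_proj M Restarting (trans_op M \<sigma> *v v))"]
    unfolding halt_prob_Cons by linarith
qed

subsection \<open>Runs with restarts\<close>

lemma nn_integral_step:
  fixes F :: "'q::finite config \<Rightarrow> real"
  assumes "unitary_matrix (trans_op M \<sigma>)" "norm v = 1"
    and "\<And>k. 0 \<le> F (post_measurement M w (trans_op M \<sigma> *v v) xs k)"
  shows "(\<integral>\<^sup>+ c. ennreal (F c) \<partial>measure_pmf (step M w (Running v (\<sigma> # xs)))) =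
    ennreal (\<Sum>k\<in>UNIV. (norm (class_proj M k (trans_op M \<sigma> *v v)))\<^sup>2
      * F (post_measurement M w (trans_op M \<sigma> *v v) xs k))"
proof -
  have "norm (trans_op M \<sigma> *v v) = 1"
    using assms by (simp add: norm_unitary_mult)
  moreover have "finite (UNIV :: state_class set)"
    by (simp add: UNIV_state_class)
  ultimately show ?thesis
    using assms(3)
    by (simp add: Let_def)
      (simp add: nn_integral_measure_pmf nn_integral_count_space_finite
        pmf_measure_outcome sum_ennreal flip: ennreal_mult)
qed

lemma run_SucE:
  assumes "(c', t') \<in> set_pmf (run M w (Suc n))"
  obtains c t where "(c, t) \<in> set_pmf (run M w n)" "c' \<in> set_pmf (step M w c)"
    "t' = (if c \<in> {Accepted, Rejected} then t else Suc t)"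
  using assms by auto

lemma step_RunningE:
  assumes "unitary_matrix (trans_op M \<sigma>)" "norm v = 1"
    and "Running v' xs' \<in> set_pmf (step M w (Running v (\<sigma> # xs)))"
  obtains (Continue) "class_proj M Nonhalting (trans_op M \<sigma> *v v) \<noteq> 0" "xs' = xs"
      "v' = inverse (norm (class_proj M Nonhalting (trans_op M \<sigma> *v v)))
        *\<^sub>R class_proj M Nonhalting (trans_op M \<sigma> *v v)"
    | (Restart) "v' = axis (init M) 1" "xs' = tape w"
proof -
  obtain k where k: "k \<in> set_pmf (measure_outcome M (trans_op M \<sigma> *v v))"
    "Running v' xs' = post_measurement M w (trans_op M \<sigma> *v v) xs k"
    using assms(3) by (auto simp: Let_def)
  have "norm (trans_op M \<sigma> *v v) = 1"
    using assms by (simp add: norm_unitary_mult)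
  with k(1) have "class_proj M k (trans_op M \<sigma> *v v) \<noteq> 0"
    by (simp add: set_pmf_iff pmf_measure_outcome)
  with k(2) that show ?thesis
    by (cases k) (auto simp: post_measurement_def start_config_def)
qed

text \<open>Halting is never undone, so a configuration that still runs has run throughout and every
  step was counted. The normalization never divides by zero, because an outcome of positive
  probability has a nonzero projection.\<close>

lemma run_Running:
  assumes "\<And>\<sigma>. unitary_matrix (trans_op M \<sigma>)"
    and "(Running v xs, t) \<in> set_pmf (run M w n)"
  shows "norm v = 1 \<and> t = n"
  using assms(2)
proof (induction n arbitrary: v xs t)
  case 0
  then show ?case
    by (simp add: start_config_def norm_axis_1)
next
  case (Suc n)
  then obtain c t0 where c: "(c, t0) \<in> set_pmf (run M w n)" "Running v xs \<in> set_pmf (step M w c)"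
    and t: "t = (if c \<in> {Accepted, Rejected} then t0 else Suc t0)"
    by (elim run_SucE)
  then obtain u ys where u: "c = Running u ys"
    by (cases c) auto
  with Suc.IH c t have n: "norm u = 1" "t = Suc n"
    by auto
  show ?case
  proof (cases ys)
    case Nil
    with c u n show ?thesis by simp
  next
    case (Cons \<sigma> zs)
    with c u have "Running v xs \<in> set_pmf (step M w (Running u (\<sigma> # zs)))"
      by simp
    with assms(1) n(1) show ?thesis
      by (cases rule: step_RunningE) (auto simp: norm_axis_1 n(2))
  qed
qed

lemma class_proj_idem: "class_proj M k (class_proj M k v) = class_proj M k v"
  by (simp add: class_proj_def vec_eq_iff)

lemma rounds_endI:
  assumes unitary: "\<And>\<sigma>. unitary_matrix (trans_op M \<sigma>)"
    and init: "class_of M (init M) = Nonhalting"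
    and right_end: "\<And>v. class_proj M Nonhalting v = v \<Longrightarrow>
      class_proj M Nonhalting (trans_op M RightEnd *v v) = 0"
  shows "rounds_end M"
proof -
  have init': "class_proj M Nonhalting (axis (init M) 1) = axis (init M) 1"
    using init by (auto simp: class_proj_def axis_def vec_eq_iff)
  \<comment> \<open>Invariant of reachable running configurations. Support on nonhalting states
    makes \<open>right_end\<close> applicable, which excludes continuing once the last symbol is
    read.\<close>
  have "(\<exists>us. xs = us @ [RightEnd]) \<and> class_proj M Nonhalting v = v"
    if "(Running v xs, t) \<in> set_pmf (run M w n)" for w n v xs t
    using that
  proof (induction n arbitrary: v xs t)
    case 0
    then show ?case
      by (simp add: start_config_def init' tape_def)
  next
    case (Suc n)
    then obtain c t0 where c: "(c, t0) \<in> set_pmf (run M w n)" "Running v xs \<in> set_pmf (step M w c)"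
      by (elim run_SucE)
    then obtain u ys where u: "c = Running u ys"
      by (cases c) auto
    with Suc.IH c obtain us where us: "ys = us @ [RightEnd]" "class_proj M Nonhalting u = u"
      by blast
    have norm: "norm u = 1"
      using run_Running[OF unitary] c u by blast
    obtain \<sigma> zs where Cons: "ys = \<sigma> # zs"
      using us(1) by (metis append_is_Nil_conv neq_Nil_conv not_Cons_self2)
    from c u Cons have "Running v xs \<in> set_pmf (step M w (Running u (\<sigma> # zs)))"
      by simp
    with unitary norm show ?case
    proof (cases rule: step_RunningE)
      case Continue
      then have "zs \<noteq> []"
        using us Cons right_end by (cases us) auto
      then have "\<exists>us. xs = us @ [RightEnd]"
        using us(1) Cons Continue by (cases us) auto
      then show ?thesis
        using Continue by (simp add: class_proj_scaleR class_proj_idem)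
    next
      case Restart
      then show ?thesis
        by (simp add: init' tape_def)
    qed
  qed
  then show ?thesis
    unfolding rounds_end_def by blast
qed

section \<open>Expected runtime on a fixed input, where \<open>h\<close> is the probability that one
  round halts\<close>

context
  fixes M :: "('q::finite) qfa_restart" and w :: "letter list" and h :: real
  assumes qfa: "is_qfa_restart M"
    and h: "halt_prob M (axis (init M) 1) (tape w) = h" "h > 0"
begin

lemma unitary_trans_op: "unitary_matrix (trans_op M \<sigma>)"
  using qfa by (simp add: is_qfa_restart_def)

lemma run_RunningE:
  assumes "(Running v xs, t) \<in> set_pmf (run M w n)"
  obtains \<sigma> ys where "xs = \<sigma> # ys" "norm v = 1" "t = n"
  using assms run_Running[OF unitary_trans_op assms] qfa
  unfolding is_qfa_restart_def rounds_end_def by (cases xs) auto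

lemma halt_prob_le_1: "norm v \<le> 1 \<Longrightarrow> halt_prob M v xs \<le> 1"
  using halt_prob_le[OF unitary_trans_op, of v xs] power_le_one[of "norm v" 2] by simp

text \<open>An inequality, since the zero vector normalizes to itself;
  \<open>nn_integral_step\<close> asks for nonnegativity even at outcomes of probability
  zero.\<close>

lemma norm_normalized_le: "norm (inverse (norm v) *\<^sub>R v) \<le> 1" for v :: "complex ^ 'q"
  by (cases "v = 0") simp_all

text \<open>An upper bound for the expected number of steps left: the rest of the current round, and, if
  that round does not halt, a geometric number of rounds of length at most \<open>length w + 2\<close>.\<close>

fun remaining_time :: "'q config \<Rightarrow> real" where
  "remaining_time (Running v xs) = length xs + (1 - halt_prob M v xs) * ((length w + 2) / h)"
| "remaining_time _ = 0"

text \<open>\<open>V = (length w + 2) / h\<close> solves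
  \<open>V = (length w + 2) + (1 - h) * V\<close>.\<close>

lemma remaining_time_start: "remaining_time (start_config M w) = (length w + 2) / h"
  using h by (simp add: start_config_def tape_def field_simps)

lemma remaining_time_nonneg:
  "norm v \<le> 1 \<Longrightarrow> 0 \<le> remaining_time (Running v xs)"
  using h halt_prob_le_1[of v xs] by simp

lemma remaining_time_post_nonneg: "0 \<le> remaining_time (post_measurement M w v xs k)"
  using remaining_time_nonneg[OF norm_normalized_le] remaining_time_start h
  by (cases k) (auto simp: post_measurement_def)

text \<open>The unread tape loses one symbol, which gives the \<open>- 1\<close>. The offset
  \<open>s\<close> leaves room for the step counter.\<close>

lemma remaining_time_step:
  assumes "norm v = 1" "0 \<le> s"
  shows "(\<integral>\<^sup>+ c. ennreal (remaining_time c + s) \<partial>measure_pmf (step M w (Running v (\<sigma> # xs))))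
    \<le> ennreal (remaining_time (Running v (\<sigma> # xs)) + s - 1)"
proof -
  let ?u = "trans_op M \<sigma> *v v" and ?V = "(length w + 2) / h"
  let ?p = "\<lambda>k. (norm (class_proj M k ?u))\<^sup>2" and ?n = "class_proj M Nonhalting ?u"
  have sum: "?p Nonhalting + ?p Accepting + ?p Rejecting + ?p Restarting = 1"
    using class_proj_sum_unitary[OF unitary_trans_op, of M \<sigma> v] assms(1) by simp
  have "?p Nonhalting * remaining_time (Running (inverse (norm ?n) *\<^sub>R ?n) xs)
      = ?p Nonhalting * (length xs + ?V) - ?p Nonhalting * halt_prob M (inverse (norm ?n) *\<^sub>R ?n) xs * ?V"
    by (simp add: algebra_simps)
  \<comment> \<open>The only loss in the estimate: \<open>?p Nonhalting * length xs\<close> is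
    enlarged to \<open>length xs\<close>.\<close>
  also have "\<dots> \<le> length xs + ?p Nonhalting * ?V - halt_prob M ?n xs * ?V"
    using sum mult_right_mono[of "?p Nonhalting" 1 "real (length xs)"]
      zero_le_power2[of "norm (class_proj M Accepting ?u)"]
      zero_le_power2[of "norm (class_proj M Rejecting ?u)"]
      zero_le_power2[of "norm (class_proj M Restarting ?u)"]
    unfolding halt_prob_normalized by (simp add: algebra_simps del: zero_le_power2)
  finally have N: "?p Nonhalting * remaining_time (Running (inverse (norm ?n) *\<^sub>R ?n) xs)
      \<le> length xs + ?p Nonhalting * ?V - halt_prob M ?n xs * ?V" .
  have "(\<Sum>k\<in>UNIV. ?p k * (remaining_time (post_measurement M w ?u xs k) + s))
      = ?p Nonhalting * remaining_time (Running (inverse (norm ?n) *\<^sub>R ?n) xs)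
        + ?p Restarting * ?V
        + (?p Nonhalting + ?p Accepting + ?p Rejecting + ?p Restarting) * s"
    by (simp add: UNIV_state_class post_measurement_def remaining_time_start
        del: remaining_time.simps(1)) (simp add: algebra_simps del: remaining_time.simps(1))
  also have "\<dots> \<le> length xs + (?p Nonhalting + ?p Restarting) * ?V - halt_prob M ?n xs * ?V + s"
    using N unfolding sum by (simp add: algebra_simps del: remaining_time.simps(1))
  also have "\<dots> = length xs + (1 - halt_prob M v (\<sigma> # xs)) * ?V + s"
  proof -
    have "?p Nonhalting + ?p Restarting - halt_prob M ?n xs = 1 - halt_prob M v (\<sigma> # xs)"
      using sum by (simp add: halt_prob_Cons)
    from arg_cong[OF this, of "\<lambda>x. x * ?V"] show ?thesis
      by (simp add: algebra_simps del: times_divide_eq_left times_divide_eq_right)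
  qed
  finally show ?thesis
    using nn_integral_step[OF unitary_trans_op assms(1), where F = "\<lambda>c. remaining_time c + s" and w = w and xs = xs]
      remaining_time_post_nonneg assms(2)
    by (simp add: ennreal_leI)
qed

lemma nn_integral_remaining_time_run:
  "(\<integral>\<^sup>+ (c, t). ennreal (remaining_time c + real t) \<partial>measure_pmf (run M w n))
    \<le> ennreal ((length w + 2) / h)"
proof (induction n)
  case 0
  then show ?case by (simp add: remaining_time_start)
next
  case (Suc n)
  have *: "(\<integral>\<^sup>+ c'. ennreal (remaining_time c' + real (if c \<in> {Accepted, Rejected} then t else Suc t))
      \<partial>measure_pmf (step M w c)) \<le> ennreal (remaining_time c + real t)"
    if reachable: "(c, t) \<in> set_pmf (run M w n)" for c t
  proof (cases c)
    case (Running v xs)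
    then obtain \<sigma> ys where "xs = \<sigma> # ys" "norm v = 1"
      using reachable by (auto elim: run_RunningE)
    \<comment> \<open>The offset \<open>1 + real t\<close> counts the current step in advance and
      cancels the \<open>- 1\<close>.\<close>
    then show ?thesis
      using Running remaining_time_step[of v "1 + real t" \<sigma> ys]
      by (simp add: add_ac del: step.simps remaining_time.simps(1))
  qed simp_all
  have "(\<integral>\<^sup>+ (c, t). ennreal (remaining_time c + real t) \<partial>measure_pmf (run M w (Suc n)))
      = (\<integral>\<^sup>+ (c, t). \<integral>\<^sup>+ c'. ennreal (remaining_time c' + real (if c \<in> {Accepted, Rejected} then t else Suc t))
      \<partial>measure_pmf (step M w c) \<partial>measure_pmf (run M w n))"
    by (simp add: case_prod_unfold)
  also have "\<dots> \<le> (\<integral>\<^sup>+ (c, t). ennreal (remaining_time c + real t) \<partial>measure_pmf (run M w n))"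
    using * by (intro nn_integral_mono_AE) (auto simp: AE_measure_pmf_iff)
  finally show ?case
    using Suc.IH by (rule order_trans)
qed

lemma nn_integral_time_run:
  "(\<integral>\<^sup>+ (c, t). of_nat t \<partial>measure_pmf (run M w n)) \<le> ennreal ((length w + 2) / h)"
proof -
  have "of_nat t \<le> ennreal (remaining_time c + real t)"
    if "(c, t) \<in> set_pmf (run M w n)" for c t
  proof -
    have "0 \<le> remaining_time c"
      using that by (cases c) (auto simp del: remaining_time.simps(1)
          intro!: remaining_time_nonneg elim!: run_RunningE)
    then show ?thesis
      unfolding ennreal_of_nat_eq_real_of_nat by (intro ennreal_leI) simp
  qed
  then have "(\<integral>\<^sup>+ (c, t). of_nat t \<partial>measure_pmf (run M w n))
      \<le> (\<integral>\<^sup>+ (c, t). ennreal (remaining_time c + real t) \<partial>measure_pmf (run M w n))"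
    by (intro nn_integral_mono_AE) (auto simp: AE_measure_pmf_iff)
  then show ?thesis
    using nn_integral_remaining_time_run by (rule order_trans)
qed

lemma expected_runtime_le: "expected_runtime M w \<le> ennreal ((length w + 2) / h)"
  unfolding expected_runtime_def by (intro SUP_least nn_integral_time_run)

section \<open>Probabilities of the eventual outcomes\<close>

context
  fixes k :: state_class and r :: real
  assumes k: "k = Accepting \<or> k = Rejecting"
    and r: "round_prob M k (axis (init M) 1) (tape w) = r * h"
begin

text \<open>The probability \<open>r\<close> of outcome \<open>k\<close> solves \<open>r = p + (1 - h) * r\<close>, where \<open>p\<close> and \<open>h\<close> are the
  probabilities that a round ends with outcome \<open>k\<close> and that it halts.\<close>

fun outcome_prob :: "'q config \<Rightarrow> real" where
  "outcome_prob (Running v xs) = round_prob M k v xs + (1 - halt_prob M v xs) * r"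
| "outcome_prob Accepted = of_bool (k = Accepting)"
| "outcome_prob Rejected = of_bool (k = Rejecting)"

lemma round_prob_le_halt_prob: "round_prob M k v xs \<le> halt_prob M v xs"
  using k by (auto simp: halt_prob_def round_prob_nonneg)

lemma outcome_prob_start: "outcome_prob (start_config M w) = r"
  using h r by (simp add: start_config_def algebra_simps)

lemma r_bounds: "0 \<le> r" "r \<le> 1"
proof -
  have "0 \<le> r * h" "r * h \<le> 1 * h"
    using h r round_prob_le_halt_prob[of "axis (init M) 1" "tape w"]
      round_prob_nonneg[of M k "axis (init M) 1" "tape w"] by simp_all
  then show "0 \<le> r" "r \<le> 1"
    using h by (simp_all add: zero_le_mult_iff)
qed

lemma outcome_prob_bounds:
  assumes "norm v \<le> 1"
  shows "0 \<le> outcome_prob (Running v xs)" "outcome_prob (Running v xs) \<le> 1"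
proof -
  have "0 \<le> 1 - halt_prob M v xs"
    using halt_prob_le_1[OF assms] by simp
  then have "0 \<le> (1 - halt_prob M v xs) * r" "(1 - halt_prob M v xs) * r \<le> 1 - halt_prob M v xs"
    using r_bounds by (simp_all add: mult_left_le)
  then show "0 \<le> outcome_prob (Running v xs)" "outcome_prob (Running v xs) \<le> 1"
    using round_prob_le_halt_prob[of v xs] round_prob_nonneg[of M k v xs]
    by (simp_all del: zero_le_mult_iff)
qed

lemma outcome_prob_post_nonneg: "0 \<le> outcome_prob (post_measurement M w v xs j)"
  using outcome_prob_bounds(1)[OF norm_normalized_le] outcome_prob_start r_bounds
  by (cases j) (auto simp: post_measurement_def)

lemma outcome_prob_step:
  assumes "norm v = 1"
  shows "(\<integral>\<^sup>+ c. ennreal (outcome_prob c) \<partial>measure_pmf (step M w (Running v (\<sigma> # xs))))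
    = ennreal (outcome_prob (Running v (\<sigma> # xs)))"
proof -
  let ?u = "trans_op M \<sigma> *v v"
  let ?p = "\<lambda>k. (norm (class_proj M k ?u))\<^sup>2" and ?n = "class_proj M Nonhalting ?u"
  have sum: "?p Nonhalting + ?p Accepting + ?p Rejecting + ?p Restarting = 1"
    using class_proj_sum_unitary[OF unitary_trans_op, of M \<sigma> v] assms by simp
  have "?p Nonhalting * outcome_prob (Running (inverse (norm ?n) *\<^sub>R ?n) xs)
      = ?p Nonhalting * round_prob M k (inverse (norm ?n) *\<^sub>R ?n) xs + ?p Nonhalting * r
        - ?p Nonhalting * halt_prob M (inverse (norm ?n) *\<^sub>R ?n) xs * r"
    by (simp add: algebra_simps)
  then have N: "?p Nonhalting * outcome_prob (Running (inverse (norm ?n) *\<^sub>R ?n) xs)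
      = round_prob M k ?n xs + ?p Nonhalting * r - halt_prob M ?n xs * r"
    unfolding halt_prob_normalized round_prob_normalized .
  have "(\<Sum>j\<in>UNIV. ?p j * outcome_prob (post_measurement M w ?u xs j))
      = ?p Nonhalting * outcome_prob (Running (inverse (norm ?n) *\<^sub>R ?n) xs)
        + ?p Restarting * r + ?p k"
    using k by (auto simp: UNIV_state_class post_measurement_def outcome_prob_start
        simp del: outcome_prob.simps(1))
  also have "\<dots> = round_prob M k v (\<sigma> # xs) + (?p Nonhalting + ?p Restarting - halt_prob M ?n xs) * r"
    unfolding N by (simp add: algebra_simps)
  also have "?p Nonhalting + ?p Restarting - halt_prob M ?n xs = 1 - halt_prob M v (\<sigma> # xs)"
    using sum by (simp add: halt_prob_Cons)
  finally show ?thesis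
    using nn_integral_step[OF unitary_trans_op assms, where F = outcome_prob and w = w and xs = xs] outcome_prob_post_nonneg
    by (simp del: step.simps round_prob.simps)
qed

lemma nn_integral_outcome_prob_run:
  "(\<integral>\<^sup>+ (c, t). ennreal (outcome_prob c) \<partial>measure_pmf (run M w n)) = ennreal r"
proof (induction n)
  case 0
  then show ?case by (simp add: outcome_prob_start)
next
  case (Suc n)
  have *: "(\<integral>\<^sup>+ c'. ennreal (outcome_prob c') \<partial>measure_pmf (step M w c)) = ennreal (outcome_prob c)"
    if reachable: "(c, t) \<in> set_pmf (run M w n)" for c t
  proof (cases c)
    case (Running v xs)
    then obtain \<sigma> ys where "xs = \<sigma> # ys" "norm v = 1"
      using reachable by (auto elim: run_RunningE)
    then show ?thesis
      using Running outcome_prob_step by simp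
  qed simp_all
  have "(\<integral>\<^sup>+ (c, t). ennreal (outcome_prob c) \<partial>measure_pmf (run M w (Suc n)))
      = (\<integral>\<^sup>+ (c, t). \<integral>\<^sup>+ c'. ennreal (outcome_prob c') \<partial>measure_pmf (step M w c) \<partial>measure_pmf (run M w n))"
    by (simp add: case_prod_unfold)
  also have "\<dots> = (\<integral>\<^sup>+ (c, t). ennreal (outcome_prob c) \<partial>measure_pmf (run M w n))"
    using * by (intro nn_integral_cong_AE) (auto simp: AE_measure_pmf_iff)
  finally show ?case
    using Suc.IH by simp
qed

abbreviation "halted \<equiv> (if k = Accepting then Accepted else Rejected)"

text \<open>The expectation of \<open>outcome_prob\<close> at time \<open>n\<close> is still
  \<open>r\<close>. Halted configurations contribute 1 or 0, and running ones at most 1. While the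
  machine runs, \<open>t = n\<close>, so Markov's inequality bounds the probability of running by
  the expected step count over \<open>n\<close>.\<close>

lemma prob_halted_ge:
  assumes "n > 0"
  shows "r - (length w + 2) / h / n \<le> measure_pmf.prob (run M w n) {(c, t). c = halted}"
proof -
  let ?S = "{(c, t). c = halted} :: ('q config \<times> nat) set"
  have *: "ennreal (outcome_prob c) \<le> indicator ?S (c, t) + ennreal (1 / n) * of_nat t"
    if reachable: "(c, t) \<in> set_pmf (run M w n)" for c t
  proof (cases c)
    case (Running v xs)
    with reachable have "norm v = 1" "t = n"
      by (auto elim: run_RunningE)
    then have le: "ennreal (outcome_prob c) \<le> ennreal 1" and eq: "ennreal (1 / n) * of_nat t = ennreal 1"
      using outcome_prob_bounds(2)[of v xs] assms Running
      by (auto intro!: ennreal_leI simp: ennreal_of_nat_eq_real_of_nat simp flip: ennreal_mult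
          simp del: ennreal_1 outcome_prob.simps(1))
    show ?thesis
      unfolding eq by (rule add_increasing[OF zero_le le])
  qed (use k in auto)
  have "ennreal r = (\<integral>\<^sup>+ (c, t). ennreal (outcome_prob c) \<partial>measure_pmf (run M w n))"
    by (simp add: nn_integral_outcome_prob_run)
  also have "\<dots> \<le> (\<integral>\<^sup>+ x. indicator ?S x + ennreal (1 / n) * (case x of (c, t) \<Rightarrow> of_nat t)
      \<partial>measure_pmf (run M w n))"
    using * by (intro nn_integral_mono_AE) (auto simp: AE_measure_pmf_iff)
  also have "\<dots> = emeasure (measure_pmf (run M w n)) ?S
      + ennreal (1 / n) * (\<integral>\<^sup>+ (c, t). of_nat t \<partial>measure_pmf (run M w n))"
    by (simp add: nn_integral_add nn_integral_cmult)
  also have "\<dots> \<le> ennreal (measure_pmf.prob (run M w n) ?S) + ennreal (1 / n) * ennreal ((length w + 2) / h)"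
    by (intro add_mono mult_left_mono nn_integral_time_run)
      (simp_all add: measure_pmf.emeasure_eq_measure)
  also have "\<dots> = ennreal (measure_pmf.prob (run M w n) ?S + (length w + 2) / h / n)"
    using h by (simp flip: ennreal_mult ennreal_plus add: mult.commute)
  finally show ?thesis
    using h by (subst (asm) ennreal_le_iff) auto
qed

lemma SUP_prob_halted_ge: "r \<le> (SUP n. measure_pmf.prob (run M w n) {(c, t). c = halted})"
    (is "_ \<le> ?S")
proof (rule LIMSEQ_le_const2)
  show "(\<lambda>n. r - (length w + 2) / h / real n) \<longlonglongrightarrow> r"
    using tendsto_diff[OF tendsto_const[of r] lim_const_over_n[of "(length w + 2) / h"]] by simp
  have "bdd_above (range (\<lambda>n. measure_pmf.prob (run M w n) {(c, t). c = halted}))"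
    by (rule bdd_aboveI[of _ 1]) auto
  then have "measure_pmf.prob (run M w n) {(c, t). c = halted} \<le> ?S" for n
    by (rule cSUP_upper[OF UNIV_I])
  then show "\<exists>N. \<forall>n\<ge>N. r - (length w + 2) / h / real n \<le> ?S"
    using prob_halted_ge by (intro exI[of _ 1]) (meson order_trans less_le_trans zero_less_one)
qed

end

lemma accept_prob_ge: "round_prob M Accepting (axis (init M) 1) (tape w) / h \<le> accept_prob M w"
  using SUP_prob_halted_ge[of Accepting "round_prob M Accepting (axis (init M) 1) (tape w) / h"] h
  by (simp add: accept_prob_def)

lemma reject_prob_ge: "round_prob M Rejecting (axis (init M) 1) (tape w) / h \<le> reject_prob M w"
  using SUP_prob_halted_ge[of Rejecting "round_prob M Rejecting (axis (init M) 1) (tape w) / h"] h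
  by (simp add: reject_prob_def)

end

lemma accept_prob_le_1: "accept_prob M w \<le> 1"
  unfolding accept_prob_def by (rule cSUP_least) auto

lemma reject_prob_nonneg: "0 \<le> reject_prob M w"
  unfolding reject_prob_def by (rule order_trans[OF _ cSUP_upper[of 0]]) (auto intro: bdd_aboveI[of _ 1])

subsection \<open>The automaton\<close>

lemma UNIV_15: "(UNIV :: 15 set) = {0, 1, 2, 3, 4, 5, 6, 7, 8, 9, 10, 11, 12, 13, 14}"
  by (rule sym, rule card_subset_eq) simp_all

text \<open>State \<open>0\<close> is initial. States \<open>1\<close>, \<open>2\<close> carry two amplitudes while the initial block of \<open>A\<close>s
  is read, and \<open>3\<close>, \<open>4\<close> carry them after the first \<open>B\<close>. States \<open>12\<close> to \<open>14\<close> only fill up the count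
  to 15.\<close>

definition state_class_15 :: "15 \<Rightarrow> state_class" where
  "state_class_15 q = (if q \<in> {0, 1, 2, 3, 4} then Nonhalting else if q \<in> {7, 8} then Rejecting
     else if q \<in> {9, 10} then Accepting else Restarting)"

text \<open>Both pairs of amplitudes are rotated into a direction that vanishes exactly for balanced words,
  sent to rejecting states, and the orthogonal direction, of which a fraction \<open>d\<close> is accepted and
  the rest restarts.\<close>

definition right_end_op :: "real \<Rightarrow> complex ^ 15 ^ 15" where
  "right_end_op d =
     rot 9 5 d (sqrt (1 - d\<^sup>2)) ** rot 2 9 0 1 ** rot 1 7 0 1 ** rot 1 2 (4/5) (3/5) **
     rot 10 6 d (sqrt (1 - d\<^sup>2)) ** rot 4 10 0 1 ** rot 3 8 0 1 ** rot 3 4 (3/5) (4/5) **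
     rot 0 11 0 1"

text \<open>The weights 3/5 and 4/5 come from a rational rotation; \<open>right_end_op\<close>
  compensates for them, so that the rejecting direction carries
  \<open>12/25 * (P - Q)\<close>.\<close>

definition left_end_op :: "complex ^ 15 ^ 15" where
  "left_end_op = rot 1 2 (3/5) (4/5) ** rot 0 1 0 1"

text \<open>The lost amplitude goes to the restarting states 5 and 6. For \<open>B\<close>, states 1
  and 3 feed one rotation and states 2 and 4 another: the first \<open>B\<close> scales the pair by
  4/5 and 3/5, later ones by 3/5 and 4/5.\<close>

fun letter_op :: "letter \<Rightarrow> complex ^ 15 ^ 15" where
  "letter_op A = rot 1 5 (4/5) (3/5) ** rot 2 6 (3/5) (4/5) ** rot 3 7 0 1 ** rot 4 8 0 1"
| "letter_op B = rot 5 3 (3/5) (4/5) ** rot 1 5 0 1 ** rot 6 4 (4/5) (3/5) ** rot 2 6 0 1"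

text \<open>The operator \<open>L\<close> is a parameter because two machines are built, one for
  \<open>\<epsilon> < 1\<close> and one for \<open>\<epsilon> \<ge> 1\<close>.\<close>

definition eq_qfa :: "complex ^ 15 ^ 15 \<Rightarrow> real \<Rightarrow> 15 qfa_restart" where
  "eq_qfa L d = \<lparr>class_of = state_class_15, init = 0,
     trans_op = case_tape_symbol L letter_op (right_end_op d)\<rparr>"

lemma eq_qfa_simps [simp]:
  "class_of (eq_qfa L d) = state_class_15"
  "init (eq_qfa L d) = 0"
  "trans_op (eq_qfa L d) LeftEnd = L"
  "trans_op (eq_qfa L d) (Letter l) = letter_op l"
  "trans_op (eq_qfa L d) RightEnd = right_end_op d"
  by (simp_all add: eq_qfa_def)

lemma rot_mult_vec_nth:
  fixes v :: "complex ^ 'n"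
  assumes "i \<noteq> j"
  shows "(rot i j c s *v v) $ p = (if p = i then of_real c * v $ i - of_real s * v $ j
     else if p = j then of_real s * v $ i + of_real c * v $ j else v $ p)"
  using assms by (simp add: rot_mult_vec)

lemmas rot_simps = matrix_vector_mul_assoc[symmetric] rot_mult_vec_nth

lemma is_qfa_restart_eq_qfa:
  assumes "unitary_matrix L" "\<bar>d\<bar> \<le> 1"
  shows "is_qfa_restart (eq_qfa L d)"
proof -
  have d: "d\<^sup>2 + (sqrt (1 - d\<^sup>2))\<^sup>2 = 1"
    using assms(2) by (simp add: abs_square_le_1)
  have letter: "unitary_matrix (letter_op l)" for l
    by (cases l) (auto intro!: unitary_matrix_mult unitary_rot simp: power2_eq_square)
  have "unitary_matrix (right_end_op d)"
    unfolding right_end_op_def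
    by (intro unitary_matrix_mult unitary_rot d) (simp_all add: power2_eq_square)
  with letter assms(1) have unitary: "unitary_matrix (trans_op (eq_qfa L d) \<sigma>)" for \<sigma>
    by (cases \<sigma>) simp_all
  have "class_proj (eq_qfa L d) Nonhalting (trans_op (eq_qfa L d) RightEnd *v v) = 0"
    if v: "class_proj (eq_qfa L d) Nonhalting v = v" for v
  proof -
    have "v $ q = 0" if "state_class_15 q \<noteq> Nonhalting" for q
      using arg_cong[OF v, of "\<lambda>v. v $ q"] that by (simp add: class_proj_def)
    \<comment> \<open>A rotation \<open>rot i j 0 1\<close> also sends minus the amplitude of
      \<open>j\<close> to \<open>i\<close>. The partners of the states 0 to 4 are 7 to 11, which are
      empty before the right end-marker is read.\<close>
    then have "v $ 7 = 0" "v $ 8 = 0" "v $ 9 = 0" "v $ 10 = 0" "v $ 11 = 0"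
      by (simp_all add: state_class_15_def)
    then have "(right_end_op d *v v) $ q = 0" if "q \<in> {0, 1, 2, 3, 4}" for q
      using that by (auto simp: right_end_op_def rot_simps)
    then show ?thesis
      by (auto simp: vec_eq_iff class_proj_def state_class_15_def)
  qed
  then have "rounds_end (eq_qfa L d)"
    by (intro rounds_endI unitary) (simp_all add: state_class_15_def)
  with unitary show ?thesis
    by (simp add: is_qfa_restart_def state_class_15_def)
qed

section \<open>The operators evaluated on real amplitude vectors\<close>

definition real_vec :: "('n \<Rightarrow> real) \<Rightarrow> complex ^ 'n" where
  "real_vec f = (\<chi> q. of_real (f q))"

definition rot_fun :: "'n \<Rightarrow> 'n \<Rightarrow> real \<Rightarrow> real \<Rightarrow> ('n \<Rightarrow> real) \<Rightarrow> 'n \<Rightarrow> real" where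
  "rot_fun i j c s f p = (if p = i then c * f i - s * f j
     else if p = j then s * f i + c * f j else f p)"

lemma rot_real_vec:
  assumes "i \<noteq> j"
  shows "rot i j c s *v real_vec f = real_vec (rot_fun i j c s f)"
  using assms by (auto simp: rot_mult_vec real_vec_def rot_fun_def vec_eq_iff)

definition amplitude_fun :: "real \<Rightarrow> real \<Rightarrow> real \<Rightarrow> real \<Rightarrow> 15 \<Rightarrow> real" where
  "amplitude_fun x y p q i = (if i = 1 then x else if i = 2 then y else if i = 3 then p
     else if i = 4 then q else 0)"

abbreviation amplitudes :: "real \<Rightarrow> real \<Rightarrow> real \<Rightarrow> real \<Rightarrow> complex ^ 15" where
  "amplitudes x y p q \<equiv> real_vec (amplitude_fun x y p q)"

lemma class_proj_eq_qfa_Nonhalting: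
  assumes "f 0 = 0"
  shows "class_proj (eq_qfa L d) Nonhalting (real_vec f) = amplitudes (f 1) (f 2) (f 3) (f 4)"
proof -
  have amp: "(if state_class_15 q = Nonhalting then f q else 0) = amplitude_fun (f 1) (f 2) (f 3) (f 4) q"
    for q
    using UNIV_I[of q] assms unfolding UNIV_15
    by (elim insertE) (simp_all add: state_class_15_def amplitude_fun_def)
  have "class_proj (eq_qfa L d) Nonhalting (real_vec f)
      = real_vec (\<lambda>q. if state_class_15 q = Nonhalting then f q else 0)"
    by (auto simp: class_proj_def real_vec_def vec_eq_iff)
  then show ?thesis
    by (simp only: amp)
qed

lemma norm_class_proj_eq_qfa:
  "(norm (class_proj (eq_qfa L d) k (real_vec f)))\<^sup>2 = (\<Sum>q | state_class_15 q = k. (f q)\<^sup>2)"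
proof -
  have "(norm (class_proj (eq_qfa L d) k (real_vec f)))\<^sup>2
      = (\<Sum>q\<in>UNIV. if state_class_15 q = k then (f q)\<^sup>2 else 0)"
    unfolding norm_vec_sq by (intro sum.cong) (simp_all add: class_proj_def real_vec_def)
  then show ?thesis
    by (simp add: sum.If_cases)
qed

lemma class_proj_eq_qfa_Accepting:
  "(norm (class_proj (eq_qfa L d) Accepting (real_vec f)))\<^sup>2 = (f 9)\<^sup>2 + (f 10)\<^sup>2"
proof -
  have "{q. state_class_15 q = Accepting} = {9, 10}"
    by (auto simp: state_class_15_def split: if_splits)
  then show ?thesis
    by (simp add: norm_class_proj_eq_qfa)
qed

lemma class_proj_eq_qfa_Rejecting:
  "(norm (class_proj (eq_qfa L d) Rejecting (real_vec f)))\<^sup>2 = (f 7)\<^sup>2 + (f 8)\<^sup>2"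
proof -
  have "{q. state_class_15 q = Rejecting} = {7, 8}"
    by (auto simp: state_class_15_def split: if_splits)
  then show ?thesis
    by (simp add: norm_class_proj_eq_qfa)
qed

lemma axis_eq_real_vec: "axis i 1 = real_vec (\<lambda>q. if q = i then 1 else 0)"
  by (simp add: axis_def real_vec_def vec_eq_iff)

lemmas amplitude_simps = matrix_vector_mul_assoc[symmetric] rot_real_vec axis_eq_real_vec
  class_proj_eq_qfa_Nonhalting class_proj_eq_qfa_Accepting class_proj_eq_qfa_Rejecting
  amplitude_fun_def rot_fun_def

lemma left_end_amplitudes:
  "class_proj (eq_qfa L d) Nonhalting (left_end_op *v axis 0 1) = amplitudes (3/5) (4/5) 0 0"
  "(norm (class_proj (eq_qfa L d) Accepting (left_end_op *v axis 0 1)))\<^sup>2 = 0"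
  "(norm (class_proj (eq_qfa L d) Rejecting (left_end_op *v axis 0 1)))\<^sup>2 = 0"
  unfolding left_end_op_def by (simp_all add: amplitude_simps)

lemma letter_A_amplitudes:
  "class_proj (eq_qfa L d) Nonhalting (letter_op A *v amplitudes x y p q)
    = amplitudes (4/5 * x) (3/5 * y) 0 0"
  "(norm (class_proj (eq_qfa L d) Accepting (letter_op A *v amplitudes x y p q)))\<^sup>2 = 0"
  "(norm (class_proj (eq_qfa L d) Rejecting (letter_op A *v amplitudes x y p q)))\<^sup>2 = p\<^sup>2 + q\<^sup>2"
  by (simp_all add: amplitude_simps)

lemma letter_B_amplitudes:
  "class_proj (eq_qfa L d) Nonhalting (letter_op B *v amplitudes x y p q)
    = amplitudes 0 0 (4/5 * x + 3/5 * p) (3/5 * y + 4/5 * q)"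
  "(norm (class_proj (eq_qfa L d) Accepting (letter_op B *v amplitudes x y p q)))\<^sup>2 = 0"
  "(norm (class_proj (eq_qfa L d) Rejecting (letter_op B *v amplitudes x y p q)))\<^sup>2 = 0"
  by (simp_all add: amplitude_simps)

lemma right_end_amplitudes:
  "(norm (class_proj (eq_qfa L d) Accepting (right_end_op d *v amplitudes x y p q)))\<^sup>2
    = d\<^sup>2 * ((3/5 * x + 4/5 * y)\<^sup>2 + (4/5 * p + 3/5 * q)\<^sup>2)"
  "(norm (class_proj (eq_qfa L d) Rejecting (right_end_op d *v amplitudes x y p q)))\<^sup>2
    = (4/5 * x - 3/5 * y)\<^sup>2 + (3/5 * p - 4/5 * q)\<^sup>2"
  unfolding right_end_op_def by (simp_all add: amplitude_simps power_mult_distrib) (simp add: distrib_left)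

subsection \<open>Acceptance and rejection weights\<close>

text \<open>\<open>acc_mass x y p q w\<close> and \<open>rej_mass x y p q w\<close> are the accepting (up to the factor \<open>d\<^sup>2\<close>) and
  rejecting weights of a round that has \<open>w\<close> left to read and amplitudes \<open>x\<close>, \<open>y\<close>, \<open>p\<close>, \<open>q\<close> in
  the states \<open>1\<close>, \<open>2\<close>, \<open>3\<close>, \<open>4\<close>.\<close>

fun acc_mass :: "real \<Rightarrow> real \<Rightarrow> real \<Rightarrow> real \<Rightarrow> letter list \<Rightarrow> real" where
  "acc_mass x y p q [] = (3/5 * x + 4/5 * y)\<^sup>2 + (4/5 * p + 3/5 * q)\<^sup>2"
| "acc_mass x y p q (A # w) = acc_mass (4/5 * x) (3/5 * y) 0 0 w"
| "acc_mass x y p q (B # w) = acc_mass 0 0 (4/5 * x + 3/5 * p) (3/5 * y + 4/5 * q) w"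

fun rej_mass :: "real \<Rightarrow> real \<Rightarrow> real \<Rightarrow> real \<Rightarrow> letter list \<Rightarrow> real" where
  "rej_mass x y p q [] = (4/5 * x - 3/5 * y)\<^sup>2 + (3/5 * p - 4/5 * q)\<^sup>2"
| "rej_mass x y p q (A # w) = p\<^sup>2 + q\<^sup>2 + rej_mass (4/5 * x) (3/5 * y) 0 0 w"
| "rej_mass x y p q (B # w) = rej_mass 0 0 (4/5 * x + 3/5 * p) (3/5 * y + 4/5 * q) w"

lemma rej_mass_nonneg: "0 \<le> rej_mass x y p q w"
  by (induction x y p q w rule: rej_mass.induct) simp_all

lemma mass_replicate_A:
  "acc_mass x y 0 0 (replicate n A @ w) = acc_mass ((4/5)^n * x) ((3/5)^n * y) 0 0 w"
  "rej_mass x y 0 0 (replicate n A @ w) = rej_mass ((4/5)^n * x) ((3/5)^n * y) 0 0 w"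
  by (induction n arbitrary: x y) (simp_all add: ac_simps)

lemma mass_replicate_B:
  "acc_mass 0 0 p q (replicate m B) = (4/5 * ((3/5)^m * p) + 3/5 * ((4/5)^m * q))\<^sup>2"
  "rej_mass 0 0 p q (replicate m B) = (3/5 * ((3/5)^m * p) - 4/5 * ((4/5)^m * q))\<^sup>2"
  by (induction m arbitrary: p q) (simp_all add: ac_simps)

lemma acc_mass_zero: "acc_mass 0 0 0 0 w = 0"
proof (induction w)
  case (Cons l w)
  then show ?case by (cases l) simp_all
qed simp

text \<open>Each \<open>B\<close> before the next \<open>A\<close> multiplies
  \<open>p\<^sup>2\<close> by 9/25. That \<open>A\<close> then rejects all of
  \<open>p\<^sup>2 + q\<^sup>2\<close> and leaves no amplitude.\<close>

lemma mass_BA: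
  assumes "A \<in> set w"
  shows "acc_mass 0 0 p q w = 0" "(9/25) ^ length w * p\<^sup>2 \<le> rej_mass 0 0 p q w"
proof -
  have "acc_mass 0 0 p q w = 0 \<and> (9/25) ^ length w * p\<^sup>2 \<le> rej_mass 0 0 p q w"
    using assms
  proof (induction w arbitrary: p q)
    case (Cons l w)
    show ?case
    proof (cases l)
      case A
      have "(9/25) ^ length (A # w) * p\<^sup>2 \<le> 1 * p\<^sup>2"
        by (intro mult_right_mono power_le_one) simp_all
      also have "\<dots> \<le> rej_mass 0 0 p q (A # w)"
        using rej_mass_nonneg[of 0 0 0 0 w] by simp
      finally show ?thesis
        using A by (simp add: acc_mass_zero)
    next
      case B
      with Cons.prems have "A \<in> set w" by simp
      with Cons.IH[of "3/5 * p" "4/5 * q"] B show ?thesis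
        by (simp add: power_mult_distrib power_divide mult.left_commute)
    qed
  qed simp
  then show "acc_mass 0 0 p q w = 0" "(9/25) ^ length w * p\<^sup>2 \<le> rej_mass 0 0 p q w"
    by simp_all
qed

lemma letter_word_cases:
  obtains n m where "w = replicate n A @ replicate m B"
  | n u where "w = replicate n A @ B # u" "A \<in> set u"
proof -
  define n where "n = length (takeWhile ((=) A) w)"
  have "takeWhile ((=) A) w = replicate n A"
    unfolding n_def by (rule replicate_eqI) (auto dest: set_takeWhileD)
  then obtain v where v: "dropWhile ((=) A) w = v" and w: "w = replicate n A @ v"
    by (metis takeWhile_dropWhile_id)
  show ?thesis
  proof (cases v)
    case Nil
    with w that(1)[of n 0] show ?thesis by simp
  next
    case (Cons l u)
    then have "l \<noteq> A"
      using v hd_dropWhile[of "(=) A" w] by auto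
    then have l: "l = B"
      by (cases l) simp_all
    show ?thesis
    proof (cases "A \<in> set u")
      case True
      with w Cons l that(2) show ?thesis by simp
    next
      case False
      then have "u = replicate (length u) B"
        by (intro replicate_eqI refl) (metis letter.exhaust)
      with w Cons l that(1)[of n "Suc (length u)"] show ?thesis by simp
    qed
  qed
qed

lemma replicate_append_in_L_eq_iff: "replicate n A @ replicate m B \<in> L_eq \<longleftrightarrow> n = m"
proof
  assume "replicate n A @ replicate m B \<in> L_eq"
  then obtain k where k: "replicate n A @ replicate m B = replicate k A @ replicate k B"
    by (auto simp: L_eq_def)
  have "count_list (replicate n A @ replicate m B) A = n" "count_list (replicate n A @ replicate m B) B = m"
    for n m by (induction n; induction m; simp)+
  with k show "n = m" by metis
qed (auto simp: L_eq_def)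

text \<open>The two products differ by a factor of at least 4/3, and
  \<open>(4/3 + 1) / (4/3 - 1) = 7\<close>.\<close>

lemma sum_le_7_diff:
  assumes "n \<noteq> m"
  shows "((3/5)^m * (4/5)^n + (4/5)^m * (3/5)^n)\<^sup>2
    \<le> 49 * ((3/5)^m * (4/5)^n - (4/5)^m * (3/5)^n :: real)\<^sup>2"
proof -
  have *: "4 * ((4/5)^m * (3/5)^n) \<le> 3 * ((3/5)^m * (4/5)^n :: real)" if less: "m < n" for m n :: nat
  proof -
    obtain k where n: "n = Suc (m + k)"
      using less less_iff_Suc_add by auto
    have "(3/5)^k \<le> (4/5 :: real)^k"
      by (intro power_mono) simp_all
    then have "(4/5)^m * (3/5)^m * (3/5)^k \<le> (4/5)^m * (3/5)^m * (4/5 :: real)^k"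
      by (intro mult_left_mono) simp_all
    then show ?thesis
      by (simp add: n power_add mult_ac)
  qed
  define P Q :: real where "P = (3/5)^m * (4/5)^n" and "Q = (4/5)^m * (3/5)^n"
  have "0 \<le> P" "0 \<le> Q"
    by (simp_all add: P_def Q_def)
  moreover have "4 * Q \<le> 3 * P \<or> 4 * P \<le> 3 * Q"
    using assms *[of m n] *[of n m] by (auto simp: P_def Q_def neq_iff mult.commute)
  ultimately have "\<bar>P + Q\<bar> \<le> \<bar>7 * (P - Q)\<bar>"
    by auto
  then have "(P + Q)\<^sup>2 \<le> (7 * (P - Q))\<^sup>2"
    by (simp add: abs_le_square_iff)
  then show ?thesis
    unfolding P_def Q_def power_mult_distrib[of 7] by simp
qed

lemma mass_replicate:
  fixes n m :: nat
  defines "P \<equiv> (3/5)^m * (4/5)^n :: real" and "Q \<equiv> (4/5)^m * (3/5)^n :: real"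
  shows "acc_mass (3/5) (4/5) 0 0 (replicate n A @ replicate m B) \<le> 256/625 * (P + Q)\<^sup>2"
    "81/625 * (P + Q)\<^sup>2 \<le> acc_mass (3/5) (4/5) 0 0 (replicate n A @ replicate m B)"
    "rej_mass (3/5) (4/5) 0 0 (replicate n A @ replicate m B) = 144/625 * (P - Q)\<^sup>2"
proof -
  have nonneg: "0 \<le> P" "0 \<le> Q"
    by (simp_all add: P_def Q_def)
  \<comment> \<open>Without any \<open>B\<close> the pair is still in states 1 and 2, with weights
    3/5 and 4/5. The first \<open>B\<close> exchanges these weights, since it scales by 4/5 and 3/5
    in place of 3/5 and 4/5.\<close>
  have acc: "acc_mass (3/5) (4/5) 0 0 (replicate n A @ replicate m B)
      = (if m = 0 then 9/25 * P + 16/25 * Q else 16/25 * P + 9/25 * Q)\<^sup>2"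
    using mass_replicate_A(1)[of "3/5" "4/5" n "[]"]
    by (cases m) (simp_all add: mass_replicate_A mass_replicate_B P_def Q_def ac_simps)
  have "(if m = 0 then 9/25 * P + 16/25 * Q else 16/25 * P + 9/25 * Q)\<^sup>2 \<le> (16/25 * (P + Q))\<^sup>2"
    "(9/25 * (P + Q))\<^sup>2 \<le> (if m = 0 then 9/25 * P + 16/25 * Q else 16/25 * P + 9/25 * Q)\<^sup>2"
    using nonneg by (auto intro!: power_mono)
  then show "acc_mass (3/5) (4/5) 0 0 (replicate n A @ replicate m B) \<le> 256/625 * (P + Q)\<^sup>2"
    "81/625 * (P + Q)\<^sup>2 \<le> acc_mass (3/5) (4/5) 0 0 (replicate n A @ replicate m B)"
    unfolding acc by (simp_all only: power_mult_distrib) (simp_all add: power_divide)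
  have "rej_mass (3/5) (4/5) 0 0 (replicate n A @ replicate m B) = (12/25 * (P - Q))\<^sup>2"
    using mass_replicate_A(2)[of "3/5" "4/5" n "[]"]
    by (cases m) (simp_all add: mass_replicate_A mass_replicate_B P_def Q_def algebra_simps)
  then show "rej_mass (3/5) (4/5) 0 0 (replicate n A @ replicate m B) = 144/625 * (P - Q)\<^sup>2"
    by (simp only: power_mult_distrib) (simp add: power_divide)
qed

lemma sum_sq_ge: "4 * (9/25) ^ (n + m) \<le> ((3/5)^m * (4/5)^n + (4/5)^m * (3/5)^n :: real)\<^sup>2"
proof -
  have "(3/5)^m * (3/5)^n \<le> (3/5)^m * (4/5 :: real)^n" "(3/5)^m * (3/5)^n \<le> (4/5)^m * (3/5 :: real)^n"
    by (intro mult_left_mono mult_right_mono power_mono; simp)+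
  then have "2 * (3/5)^(n + m) \<le> (3/5)^m * (4/5)^n + (4/5)^m * (3/5 :: real)^n"
    unfolding power_add mult.commute[of "(3/5)^n" "(3/5)^m"] by linarith
  then have "(2 * (3/5)^(n + m))\<^sup>2 \<le> ((3/5)^m * (4/5)^n + (4/5)^m * (3/5)^n :: real)\<^sup>2"
    by (intro power_mono) simp_all
  moreover have "(2 * (3/5)^k)\<^sup>2 = 4 * (9/25 :: real)^k" for k
    by (simp add: power2_eq_square flip: power_mult_distrib)
  ultimately show ?thesis by simp
qed

lemma mass_in_L_eq:
  assumes "w \<in> L_eq"
  shows "rej_mass (3/5) (4/5) 0 0 w = 0"
    and "(9/25) ^ length w / 100 \<le> acc_mass (3/5) (4/5) 0 0 w"
proof -
  obtain n where w: "w = replicate n A @ replicate n B"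
    using assms by (auto simp: L_eq_def)
  show "rej_mass (3/5) (4/5) 0 0 w = 0"
    unfolding w mass_replicate by simp
  have "(9/25) ^ length w / 100 \<le> 81/625 * (4 * (9/25 :: real) ^ (n + n))"
    by (simp add: w)
  also have "\<dots> \<le> 81/625 * ((3/5)^n * (4/5)^n + (4/5)^n * (3/5)^n)\<^sup>2"
    by (intro mult_left_mono sum_sq_ge) simp
  also have "\<dots> \<le> acc_mass (3/5) (4/5) 0 0 w"
    unfolding w by (rule mass_replicate)
  finally show "(9/25) ^ length w / 100 \<le> acc_mass (3/5) (4/5) 0 0 w" .
qed

text \<open>For two blocks of unequal length the ratio is at most
  \<open>49 * 256 / 144 < 88\<close>, and 144 is a convenient larger square. The rejecting weight is
  then at least \<open>4 * 144 / (625 * 49)\<close> times the power, which exceeds 1/100 of it. If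
  an \<open>A\<close> follows a \<open>B\<close>, nothing is accepted.\<close>

lemma mass_notin_L_eq:
  assumes "w \<notin> L_eq"
  shows "acc_mass (3/5) (4/5) 0 0 w \<le> 144 * rej_mass (3/5) (4/5) 0 0 w"
    and "(9/25) ^ length w / 100 \<le> rej_mass (3/5) (4/5) 0 0 w"
proof -
  have "acc_mass (3/5) (4/5) 0 0 w \<le> 144 * rej_mass (3/5) (4/5) 0 0 w
    \<and> (9/25) ^ length w / 100 \<le> rej_mass (3/5) (4/5) 0 0 w"
  proof (cases w rule: letter_word_cases)
    case (1 n m)
    define P Q :: real where "P = (3/5)^m * (4/5)^n" and "Q = (4/5)^m * (3/5)^n"
    have "n \<noteq> m"
      using assms 1 replicate_append_in_L_eq_iff by simp
    then have "(P + Q)\<^sup>2 \<le> 49 * (P - Q)\<^sup>2" "4 * (9/25) ^ length w \<le> (P + Q)\<^sup>2"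
      using sum_le_7_diff[of n m] sum_sq_ge[of n m] by (simp_all add: P_def Q_def 1)
    moreover have "acc_mass (3/5) (4/5) 0 0 w \<le> 256/625 * (P + Q)\<^sup>2"
      "rej_mass (3/5) (4/5) 0 0 w = 144/625 * (P - Q)\<^sup>2"
      unfolding 1 P_def Q_def by (rule mass_replicate)+
    moreover have "0 \<le> (P - Q)\<^sup>2"
      by simp
    ultimately show ?thesis
      by linarith
  next
    case (2 n u)
    \<comment> \<open>The amplitude in state 3 after the first \<open>B\<close>.\<close>
    let ?p = "4/5 * ((4/5)^n * (3/5)) :: real"
    have "(9/25) ^ length w / 100 \<le> (9/25) ^ length u * ((9/25)^n * (12/25 :: real)\<^sup>2)"
      by (simp add: 2 power_add power2_eq_square)
    also have "\<dots> \<le> (9/25) ^ length u * ((16/25)^n * (12/25 :: real)\<^sup>2)"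
      by (intro mult_left_mono mult_right_mono power_mono) simp_all
    also have "\<dots> = (9/25) ^ length u * ?p\<^sup>2"
    proof -
      have "(16/25 :: real)^n = ((4/5)^n)\<^sup>2"
        by (simp add: power2_eq_square flip: power_mult_distrib)
      then show ?thesis
        by (simp add: power_mult_distrib power2_eq_square)
    qed
    also have "\<dots> \<le> rej_mass (3/5) (4/5) 0 0 w"
      using mass_BA(2)[OF 2(2), of ?p] by (simp add: 2(1) mass_replicate_A)
    finally have "(9/25) ^ length w / 100 \<le> rej_mass (3/5) (4/5) 0 0 w" .
    moreover have "acc_mass (3/5) (4/5) 0 0 w = 0"
      using mass_BA(1)[OF 2(2)] by (simp add: 2(1) mass_replicate_A)
    ultimately show ?thesis
      using rej_mass_nonneg[of "3/5" "4/5" 0 0 w] by simp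
  qed
  then show "acc_mass (3/5) (4/5) 0 0 w \<le> 144 * rej_mass (3/5) (4/5) 0 0 w"
    and "(9/25) ^ length w / 100 \<le> rej_mass (3/5) (4/5) 0 0 w"
    by simp_all
qed

section \<open>Round probabilities of the two machines, and the theorem\<close>

lemma round_prob_amplitudes:
  "round_prob (eq_qfa L d) Accepting (amplitudes x y p q) (map Letter w @ [RightEnd])
    = d\<^sup>2 * acc_mass x y p q w"
  "round_prob (eq_qfa L d) Rejecting (amplitudes x y p q) (map Letter w @ [RightEnd])
    = rej_mass x y p q w"
proof (induction w arbitrary: x y p q)
  case Nil
  case 1
  then show ?case by (simp add: right_end_amplitudes)
  case 2
  then show ?case by (simp add: right_end_amplitudes)
next
  case (Cons l w)
  case 1
  then show ?case
    using Cons.IH(1) by (cases l) (simp_all only: list.map append_Cons round_prob.simps eq_qfa_simps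
        letter_A_amplitudes letter_B_amplitudes acc_mass.simps add_0)
  case 2
  then show ?case
    using Cons.IH(2) by (cases l) (simp_all only: list.map append_Cons round_prob.simps eq_qfa_simps
        letter_A_amplitudes letter_B_amplitudes rej_mass.simps add_0)
qed

lemma round_prob_tape:
  "round_prob (eq_qfa left_end_op d) Accepting (axis 0 1) (tape w) = d\<^sup>2 * acc_mass (3/5) (4/5) 0 0 w"
  "round_prob (eq_qfa left_end_op d) Rejecting (axis 0 1) (tape w) = rej_mass (3/5) (4/5) 0 0 w"
  by (simp_all only: tape_def round_prob.simps eq_qfa_simps left_end_amplitudes
      round_prob_amplitudes add_0)

lemma unitary_left_end_op: "unitary_matrix left_end_op"
  unfolding left_end_op_def
  by (intro unitary_matrix_mult unitary_rot) (simp_all add: power2_eq_square)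

text \<open>For \<open>\<epsilon> \<ge> 1\<close> rejection is not required, but the time bound decreases with \<open>\<epsilon>\<close>; a machine that
  accepts on the left end-marker is used there.\<close>

definition accept_at_once_op :: "complex ^ 15 ^ 15" where
  "accept_at_once_op = rot 0 9 0 1"

lemma unitary_accept_at_once_op: "unitary_matrix accept_at_once_op"
  unfolding accept_at_once_op_def by (rule unitary_rot) simp_all

lemma accept_at_once:
  "round_prob (eq_qfa accept_at_once_op d) Accepting (axis 0 1) (tape w) = 1"
  "halt_prob (eq_qfa accept_at_once_op d) (axis 0 1) (tape w) = 1"
proof -
  have non: "class_proj (eq_qfa accept_at_once_op d) Nonhalting (accept_at_once_op *v axis 0 1)
      = amplitudes 0 0 0 0"
    and acc: "(norm (class_proj (eq_qfa accept_at_once_op d) Accepting (accept_at_once_op *v axis 0 1)))\<^sup>2 = 1"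
    and rej: "(norm (class_proj (eq_qfa accept_at_once_op d) Rejecting (accept_at_once_op *v axis 0 1)))\<^sup>2 = 0"
    by (simp_all add: accept_at_once_op_def amplitude_simps)
  have zero: "amplitudes 0 0 0 0 = 0"
    by (simp add: real_vec_def amplitude_fun_def vec_eq_iff)
  have "round_prob (eq_qfa accept_at_once_op d) k (amplitudes 0 0 0 0) xs = 0" for k xs
    using round_prob_scaleR[of _ k 0 "amplitudes 0 0 0 0" xs] by (simp add: zero)
  then show "round_prob (eq_qfa accept_at_once_op d) Accepting (axis 0 1) (tape w) = 1"
    "halt_prob (eq_qfa accept_at_once_op d) (axis 0 1) (tape w) = 1"
    by (simp_all only: halt_prob_def tape_def round_prob.simps eq_qfa_simps non acc rej add_0_right)
qed

lemma power_25_9_le: "(25/9 :: real) ^ n \<le> (2 * sqrt 2) ^ n"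
proof -
  have "25/18 \<le> sqrt 2"
    by (rule real_le_rsqrt) (simp add: power2_eq_square)
  then show ?thesis
    by (intro power_mono) simp_all
qed

theorem theorem24:
  "\<exists>C::real. \<forall>\<epsilon>::real. \<epsilon> > 0 \<longrightarrow>
     (\<exists>M :: 15 qfa_restart.
        is_qfa_restart M \<and>
        (\<forall>w. w \<in> L_eq \<longrightarrow> accept_prob M w = 1) \<and>
        (\<forall>w. w \<notin> L_eq \<longrightarrow> reject_prob M w \<ge> 1 - \<epsilon>) \<and>
        (\<forall>w. real (length w) \<ge> max 1 \<epsilon> \<longrightarrow>
           expected_runtime M w \<le>
             ennreal (C * ((1 / \<epsilon>) * (2 * sqrt 2) ^ length w * real (length w)))))"
proof (intro exI[of _ 43200] allI impI)
  fix \<epsilon> :: real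
  assume "\<epsilon> > 0"
  \<comment> \<open>\<open>43200 = 3 * 144 * 100\<close>: 3 from
    \<open>length w + 2 \<le> 3 * length w\<close>, 144 from
    \<open>d\<^sup>2 = \<epsilon> / 144\<close>, and 100 from the lower bounds on the
    weights.\<close>
  let ?bound = "\<lambda>w. 43200 * ((1 / \<epsilon>) * (2 * sqrt 2) ^ length w * real (length w))"
  show "\<exists>M :: 15 qfa_restart. is_qfa_restart M \<and>
        (\<forall>w. w \<in> L_eq \<longrightarrow> accept_prob M w = 1) \<and>
        (\<forall>w. w \<notin> L_eq \<longrightarrow> reject_prob M w \<ge> 1 - \<epsilon>) \<and>
        (\<forall>w. real (length w) \<ge> max 1 \<epsilon> \<longrightarrow> expected_runtime M w \<le> ennreal (?bound w))"
  proof (cases "\<epsilon> < 1")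
    case True
    \<comment> \<open>The square of \<open>d\<close> cancels the factor 144 of
      \<open>mass_notin_L_eq\<close>, so acceptance has at most \<open>\<epsilon>\<close> times the
      weight of rejection.\<close>
    define d where "d = sqrt \<epsilon> / 12"
    define M where "M = eq_qfa left_end_op d"
    have "sqrt \<epsilon> \<le> 12"
      by (rule order_trans[of _ 1]) (use True in simp_all)
    then have d: "d\<^sup>2 = \<epsilon> / 144" "\<bar>d\<bar> \<le> 1"
      using True \<open>\<epsilon> > 0\<close> by (simp_all add: d_def power_divide)
    have qfa: "is_qfa_restart M"
      unfolding M_def by (intro is_qfa_restart_eq_qfa unitary_left_end_op d)
    define acc rej where "acc w = \<epsilon> / 144 * acc_mass (3/5) (4/5) 0 0 w"
      and "rej w = rej_mass (3/5) (4/5) 0 0 w" for w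
    have prob: "round_prob M Accepting (axis (init M) 1) (tape w) = acc w"
      "round_prob M Rejecting (axis (init M) 1) (tape w) = rej w"
      "halt_prob M (axis (init M) 1) (tape w) = acc w + rej w" for w
      by (simp_all only: M_def eq_qfa_simps halt_prob_def round_prob_tape d acc_def rej_def)
    have halt: "\<epsilon> / 14400 * (9/25) ^ length w \<le> acc w + rej w" for w
    proof (cases "w \<in> L_eq")
      case True
      then have "\<epsilon> / 144 * ((9/25) ^ length w / 100) \<le> acc w"
        unfolding acc_def using \<open>\<epsilon> > 0\<close> by (intro mult_left_mono mass_in_L_eq) simp_all
      then show ?thesis
        using mass_in_L_eq(1)[OF True] by (simp add: rej_def)
    next
      case False
      have "\<epsilon> / 14400 * (9/25) ^ length w \<le> 1 / 100 * (9/25 :: real) ^ length w"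
        using \<open>\<epsilon> < 1\<close> by (intro mult_right_mono) simp_all
      moreover have "0 \<le> acc w"
        using round_prob_nonneg prob(1) by metis
      ultimately show ?thesis
        using mass_notin_L_eq(2)[OF False] unfolding rej_def by linarith
    qed
    have pos: "0 < acc w + rej w" for w
      by (rule less_le_trans[OF _ halt]) (use \<open>\<epsilon> > 0\<close> in simp)
    have "accept_prob M w = 1" if "w \<in> L_eq" for w
    proof -
      have "rej w = 0"
        using mass_in_L_eq(1)[OF that] by (simp add: rej_def)
      then show ?thesis
        using accept_prob_ge[OF qfa prob(3)[of w] pos] pos[of w] accept_prob_le_1[of M w] by (simp add: prob)
    qed
    moreover have "1 - \<epsilon> \<le> reject_prob M w" if "w \<notin> L_eq" for w
    proof -
      have "acc w \<le> \<epsilon> / 144 * (144 * rej w)"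
        unfolding acc_def rej_def using \<open>\<epsilon> > 0\<close> that by (intro mult_left_mono mass_notin_L_eq) simp_all
      moreover have "0 \<le> \<epsilon> * acc w"
        using \<open>\<epsilon> > 0\<close> round_prob_nonneg[of M Accepting "axis (init M) 1" "tape w"] by (simp add: prob)
      ultimately have "(1 - \<epsilon>) * (acc w + rej w) \<le> rej w"
        by (simp add: algebra_simps)
      then have "1 - \<epsilon> \<le> rej w / (acc w + rej w)"
        using pos[of w] by (simp add: pos_le_divide_eq)
      also have "\<dots> \<le> reject_prob M w"
        using reject_prob_ge[OF qfa prob(3)[of w] pos] by (simp add: prob)
      finally show ?thesis .
    qed
    moreover have "expected_runtime M w \<le> ennreal (?bound w)" if "max 1 \<epsilon> \<le> real (length w)" for w
    proof -
      have "(length w + 2) / (acc w + rej w) \<le> 3 * length w / (\<epsilon> / 14400 * (9/25) ^ length w)"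
        using that halt \<open>\<epsilon> > 0\<close> by (intro frac_le) simp_all
      also have "\<dots> = 43200 * (1 / \<epsilon> * (25/9) ^ length w * length w)"
        by (simp add: power_divide field_simps)
      also have "\<dots> \<le> ?bound w"
        using \<open>\<epsilon> > 0\<close> by (intro mult_left_mono mult_right_mono power_25_9_le) simp_all
      finally have "ennreal ((length w + 2) / (acc w + rej w)) \<le> ennreal (?bound w)"
        by (rule ennreal_leI)
      with expected_runtime_le[OF qfa prob(3)[of w] pos] show ?thesis
        by (rule order_trans)
    qed
    ultimately show ?thesis
      using qfa by blast
  next
    case False
    define M where "M = eq_qfa accept_at_once_op 0"
    have qfa: "is_qfa_restart M"
      unfolding M_def by (intro is_qfa_restart_eq_qfa unitary_accept_at_once_op) simp
    have halt: "halt_prob M (axis (init M) 1) (tape w) = 1" for w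
      by (simp only: M_def eq_qfa_simps accept_at_once)
    have "accept_prob M w = 1" for w
    proof (rule antisym[OF accept_prob_le_1])
      have "round_prob M Accepting (axis (init M) 1) (tape w) = 1"
        by (simp only: M_def eq_qfa_simps accept_at_once)
      then show "1 \<le> accept_prob M w"
        using accept_prob_ge[OF qfa halt[of w] zero_less_one] by simp
    qed
    moreover have "1 - \<epsilon> \<le> reject_prob M w" for w
      using False reject_prob_nonneg[of M w] by simp
    moreover have "expected_runtime M w \<le> ennreal (?bound w)" if "max 1 \<epsilon> \<le> real (length w)" for w
    proof -
      \<comment> \<open>Here \<open>h = 1\<close>. Bernoulli's inequality lets the exponential
        absorb \<open>length w + 2\<close>, and \<open>\<epsilon> \<le> length w\<close> makes the
        factor \<open>length w / \<epsilon>\<close> at least 1.\<close>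
      have "1 + real (length w) * (25/9 - 1) \<le> (1 + (25/9 - 1)) ^ length w"
        by (rule Bernoulli_inequality) simp
      then have "length w + 2 \<le> 43200 * (1 * (25/9 :: real) ^ length w)"
        by simp
      also have "\<dots> \<le> 43200 * (real (length w) / \<epsilon> * (2 * sqrt 2) ^ length w)"
        using that \<open>\<epsilon> > 0\<close> by (intro mult_left_mono mult_mono power_25_9_le) simp_all
      also have "\<dots> = ?bound w"
        by simp
      finally have "ennreal ((length w + 2) / 1) \<le> ennreal (?bound w)"
        by (intro ennreal_leI) simp
      with expected_runtime_le[OF qfa halt[of w] zero_less_one] show ?thesis
        by (rule order_trans)
    qed
    ultimately show ?thesis
      using qfa by blast
  qed
qed

end
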